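(* For any triangle-free strongly regular graph $G$, $\beta(G)\leq\frac1{50}$.
   Context: All graphs are finite and simple. A regular triangle-free graph $G$ is called strongly regular if $|N_G(v)\cap N_G(w)|$ takes the same value $c$ for all pairs $(v,w)$ of distinct non-adjacent vertices, where $N_G(v)$ is the set of neighbours of $v$. For a graph $G$ with $n\geq 1$ vertices, a half in $G$ is a function $\mu: V(G)\to[0,1]$ such that $\sum_{v\in V(G)}\mu(v)=n/2$. Put $\beta(G,\mu)=\frac1{n^2}\sum_{\{u,v\}\in E(G)}\mu(u)\mu(v)$ (each edge is counted once) and $\beta(G)=\min\{\beta(G,\mu): \mu \text{ is a half in } G\}$. *)

theory Defs
  imports "HOL-Analysis.Analysis" "Graph_Theory.Pair_Digraph"
begin

text \<open>
  Finite simple graphs are \<^locale>\<open>pair_graph\<close>s: finite, loop-free digraphs whose set of arcs is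
  symmetric. Each undirected edge \<open>{u, v}\<close> is thus represented by the two arcs \<open>(u, v)\<close>
  and \<open>(v, u)\<close>; the set \<open>edges G\<close> contains it once.
\<close>

definition edges :: "'a pair_pre_digraph \<Rightarrow> 'a set set" where
  "edges G = {{u, v} | u v. (u, v) \<in> parcs G}"

definition nbhd :: "'a pair_pre_digraph \<Rightarrow> 'a \<Rightarrow> 'a set" where
  "nbhd G v = {w \<in> pverts G. (v, w) \<in> parcs G}"

definition regular :: "'a pair_pre_digraph \<Rightarrow> bool" where
  "regular G \<longleftrightarrow> (\<exists>d. \<forall>v \<in> pverts G. card (nbhd G v) = d)"

definition triangle_free :: "'a pair_pre_digraph \<Rightarrow> bool" where
  "triangle_free G \<longleftrightarrow>
     \<not> (\<exists>u v w. (u, v) \<in> parcs G \<and> (v, w) \<in> parcs G \<and> (u, w) \<in> parcs G)"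

text \<open>If there are no two distinct non-adjacent vertices, the condition on \<open>c\<close> is vacuous.\<close>

definition triangle_free_strongly_regular :: "'a pair_pre_digraph \<Rightarrow> bool" where
  "triangle_free_strongly_regular G \<longleftrightarrow>
     pair_graph G \<and> regular G \<and> triangle_free G \<and>
     (\<exists>c. \<forall>v \<in> pverts G. \<forall>w \<in> pverts G. v \<noteq> w \<and> (v, w) \<notin> parcs G \<longrightarrow>
        card (nbhd G v \<inter> nbhd G w) = c)"

text \<open>The values of a half outside the vertex set are irrelevant and left unconstrained.\<close>

definition halves :: "'a pair_pre_digraph \<Rightarrow> ('a \<Rightarrow> real) set" where
  "halves G = {\<mu> \<in> pverts G \<rightarrow> {0..1}. (\<Sum>v\<in>pverts G. \<mu> v) = real (card (pverts G)) / 2}"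

text \<open>For an edge \<open>e = {u, v}\<close> the product over \<open>e\<close> is \<open>\<mu> u * \<mu> v\<close>.\<close>

definition half_density :: "'a pair_pre_digraph \<Rightarrow> ('a \<Rightarrow> real) \<Rightarrow> real" where
  "half_density G \<mu> = 1 / real (card (pverts G)) ^ 2 * (\<Sum>e\<in>edges G. \<Prod>v\<in>e. \<mu> v)"

text \<open>
  The minimum over all halves. It is written as an infimum because \<^const>\<open>Min\<close> only applies to finite
  sets; \<open>sparse_half_density_is_minimum\<close> below shows that it is attained.
\<close>

definition sparse_half_density :: "'a pair_pre_digraph \<Rightarrow> real" where
  "sparse_half_density G = (INF \<mu>\<in>halves G. half_density G \<mu>)"

lemma edges_subset_pverts:
  assumes "pair_graph G" "e \<in> edges G"
  shows "e \<subseteq> pverts G"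
proof -
  interpret pair_graph G by fact
  show ?thesis
    using assms(2) in_arcsD1 in_arcsD2 by (auto simp: edges_def)
qed

lemma half_density_cong:
  assumes "pair_graph G" "\<And>v. v \<in> pverts G \<Longrightarrow> \<mu> v = \<nu> v"
  shows "half_density G \<mu> = half_density G \<nu>"
proof -
  have "(\<Prod>v\<in>e. \<mu> v) = (\<Prod>v\<in>e. \<nu> v)" if "e \<in> edges G" for e
    using edges_subset_pverts[OF assms(1) that] assms(2) by (intro prod.cong) auto
  then show ?thesis
    by (simp add: half_density_def)
qed

lemma half_density_attains_inf:
  assumes G: "pair_graph G"
  shows "\<exists>\<mu>\<in>halves G. \<forall>\<nu>\<in>halves G. half_density G \<mu> \<le> half_density G \<nu>"
proof -
  define K :: "('a \<Rightarrow> real) set" where "K = PiE UNIV (\<lambda>v. if v \<in> pverts G then {0..1} else {0})"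
  define H where "H = K \<inter> {\<mu>. (\<Sum>v\<in>pverts G. \<mu> v) = real (card (pverts G)) / 2}"
  have "compact K"
    unfolding K_def compactin_euclidean_iff[symmetric] euclidean_product_topology[symmetric]
    by (simp add: compactin_PiE)
  moreover have cont: "continuous_on UNIV (\<lambda>\<mu>::'a \<Rightarrow> real. \<mu> v)" for v
    by (rule continuous_on_product_coordinates)
  have "closed {\<mu>::'a \<Rightarrow> real. (\<Sum>v\<in>pverts G. \<mu> v) = real (card (pverts G)) / 2}"
    by (intro closed_Collect_eq continuous_on_sum cont continuous_on_const)
  ultimately have "compact H"
    unfolding H_def by (rule compact_Int_closed)
  moreover have "(\<lambda>v. if v \<in> pverts G then 1 / 2 else 0) \<in> H"
    by (auto simp: H_def K_def)
  then have "H \<noteq> {}" by blast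
  moreover have "continuous_on H (half_density G)"
    unfolding half_density_def
    by (intro continuous_intros continuous_on_subset[OF cont]) auto
  ultimately obtain \<mu> where \<mu>: "\<mu> \<in> H" "\<And>\<nu>. \<nu> \<in> H \<Longrightarrow> half_density G \<mu> \<le> half_density G \<nu>"
    using continuous_attains_inf by metis
  have "\<mu> \<in> halves G"
    using \<mu>(1) by (auto simp: H_def K_def halves_def PiE_iff Pi_iff split: if_splits)
  moreover have "half_density G \<mu> \<le> half_density G \<nu>" if "\<nu> \<in> halves G" for \<nu>
  proof -
    define \<nu>' where "\<nu>' = (\<lambda>v. if v \<in> pverts G then \<nu> v else 0)"
    have "\<nu>' \<in> H"
      using that by (auto simp: H_def K_def halves_def PiE_iff Pi_iff \<nu>'_def)
    then have "half_density G \<mu> \<le> half_density G \<nu>'" by (rule \<mu>(2))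
    also have "\<dots> = half_density G \<nu>"
      by (rule half_density_cong[OF G]) (simp add: \<nu>'_def)
    finally show ?thesis .
  qed
  ultimately show ?thesis by blast
qed

lemma sparse_half_density_is_minimum:
  assumes "pair_graph G"
  shows "sparse_half_density G \<in> half_density G ` halves G"
    and "\<And>\<mu>. \<mu> \<in> halves G \<Longrightarrow> sparse_half_density G \<le> half_density G \<mu>"
proof -
  obtain \<mu> where \<mu>: "\<mu> \<in> halves G" "\<forall>\<nu>\<in>halves G. half_density G \<mu> \<le> half_density G \<nu>"
    using half_density_attains_inf[OF assms] by blast
  then have "sparse_half_density G = half_density G \<mu>"
    unfolding sparse_half_density_def by (intro cInf_eq_minimum) auto
  then show "sparse_half_density G \<in> half_density G ` halves G"
    and "\<And>\<nu>. \<nu> \<in> halves G \<Longrightarrow> sparse_half_density G \<le> half_density G \<nu>"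
    using \<mu> by auto
qed

end

theory Submission
  imports Defs
begin

text \<open>
  All halves used have weight \<open>1\<close> on a set \<open>A\<close>, a constant \<open>t\<close> on a set \<open>B\<close>, and \<open>0\<close> elsewhere.
  Let \<open>k\<close> be the degree and \<open>c\<close> the number of common neighbours. The constant half settles
  \<open>25 k \<le> 4 n\<close>. If \<open>k \<le> 2 c\<close>, then either \<open>k = c\<close> and \<open>n = 2 k\<close>, or \<open>(n, k, c)\<close> are the parameters of
  the pentagon; here the neighbourhoods of two vertices at distance two suffice. If \<open>k > 2 c\<close>, the Krein
  condition, which for triangle-free graphs is a Cauchy--Schwarz inequality, leaves finitely many pairs
  \<open>(k, c)\<close>. For these take \<open>N v \<union> N w\<close> without the ends of an edge \<open>v w\<close>, together with either all of
  the vertices at distance two from the edge, or, after removing one \<open>p \<in> N v\<close>, only those in \<open>N p\<close>.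
\<close>

section \<open>Arc counts and two-valued halves in regular triangle-free graphs\<close>

lemma sum_mult_indicator:
  fixes f :: "'a \<Rightarrow> real"
  assumes "finite V" "A \<subseteq> V"
  shows "(\<Sum>x\<in>V. f x * of_bool (x \<in> A)) = sum f A"
  using assms by (subst sum.mono_neutral_right[of V A]) auto

locale tf_regular = pair_graph G for G :: "'a pair_pre_digraph" +
  fixes k :: nat
  assumes card_nbhd: "v \<in> pverts G \<Longrightarrow> card (nbhd G v) = k"
    and triangle_free: "triangle_free G"
    and nonempty: "pverts G \<noteq> {}"
begin

abbreviation V :: "'a set" where "V \<equiv> pverts G"
abbreviation N :: "'a \<Rightarrow> 'a set" where "N \<equiv> nbhd G"

lemma nbhd_iff: "w \<in> N v \<longleftrightarrow> (v, w) \<in> parcs G"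
  using in_arcsD2 by (auto simp: nbhd_def)

lemma nbhd_sym: "w \<in> N v \<longleftrightarrow> v \<in> N w"
  using arcs_symmetric by (auto simp: nbhd_iff)

lemma nbhd_verts: "w \<in> N v \<Longrightarrow> v \<in> V" "w \<in> N v \<Longrightarrow> w \<in> V"
  using in_arcsD1 in_arcsD2 by (auto simp: nbhd_iff)

lemma nbhd_subset: "N v \<subseteq> V"
  using nbhd_verts by blast

lemma finite_nbhd [simp]: "finite (N v)"
  by (rule finite_subset[OF nbhd_subset]) simp

lemma not_self_nbhd [simp]: "v \<notin> N v"
  by (auto simp: nbhd_iff dest: no_loops')

lemma nbhd_Int_nbhd: "w \<in> N v \<Longrightarrow> N w \<inter> N v = {}"
  using triangle_free by (auto simp: triangle_free_def nbhd_iff)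

lemma nbhd_indep: "x \<in> N v \<Longrightarrow> y \<in> N v \<Longrightarrow> y \<notin> N x"
  using nbhd_Int_nbhd by blast

text \<open>Ordered adjacent pairs are counted, so for finite \<open>A\<close> an edge inside
  \<open>A\<close> contributes twice to \<open>arcs_between A A\<close>.\<close>

definition arcs_between :: "'a set \<Rightarrow> 'a set \<Rightarrow> nat" where
  "arcs_between A B = (\<Sum>x\<in>A. card (N x \<inter> B))"

lemma card_nbhd_Int:
  assumes "finite B"
  shows "card (N x \<inter> B) = (\<Sum>y\<in>B. of_bool (y \<in> N x))"
proof -
  have "N x \<inter> B = B \<inter> {y. y \<in> N x}" by blast
  then show ?thesis using assms by (simp add: sum_of_bool_eq)
qed

lemma arcs_between_commute:
  assumes "finite A" "finite B"
  shows "arcs_between A B = arcs_between B A"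
proof -
  have "arcs_between A B = (\<Sum>x\<in>A. \<Sum>y\<in>B. of_bool (y \<in> N x))"
    using assms by (simp add: arcs_between_def card_nbhd_Int)
  also have "\<dots> = (\<Sum>y\<in>B. \<Sum>x\<in>A. of_bool (x \<in> N y))"
    by (subst sum.swap) (simp add: nbhd_sym)
  finally show ?thesis using assms by (simp add: arcs_between_def card_nbhd_Int)
qed

lemma arcs_between_const:
  assumes "\<And>x. x \<in> A \<Longrightarrow> card (N x \<inter> B) = m"
  shows "arcs_between A B = card A * m"
  using assms by (simp add: arcs_between_def)

lemma arcs_between_Un:
  assumes "finite A" "finite B" "A \<inter> B = {}"
  shows "arcs_between (A \<union> B) C = arcs_between A C + arcs_between B C"
  unfolding arcs_between_def using assms by (rule sum.union_disjoint)

lemma arcs_between_verts: "S \<subseteq> V \<Longrightarrow> arcs_between V S = card S * k"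
  using arcs_between_commute[of V S] arcs_between_const[of S V k] card_nbhd nbhd_subset
  by (simp add: finite_subset Int_absorb2 subset_iff)

text \<open>Sending an arc to its pair of ends has fibres of size two over the edges, since arcs are
  symmetric and loop-free; grouping the arcs by edge gives the factor 2.\<close>

lemma sum_edges:
  fixes \<mu> :: "'a \<Rightarrow> real"
  shows "2 * (\<Sum>e\<in>edges G. \<Prod>v\<in>e. \<mu> v) = (\<Sum>u\<in>V. \<Sum>w\<in>N u. \<mu> u * \<mu> w)"
proof -
  have fiber: "(\<Sum>a\<in>{a \<in> parcs G. {fst a, snd a} = e}. \<mu> (fst a) * \<mu> (snd a)) = 2 * (\<Prod>v\<in>e. \<mu> v)"
    if e: "e \<in> edges G" for e
  proof -
    obtain u v where uv: "e = {u, v}" "(u, v) \<in> parcs G" using e by (auto simp: edges_def)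
    then have "(v, u) \<in> parcs G" using arcs_symmetric by blast
    moreover have "u \<noteq> v" using no_loops'[OF uv(2)] .
    moreover have "{a \<in> parcs G. {fst a, snd a} = e} = {(u, v), (v, u)}"
      using uv calculation by (auto simp: doubleton_eq_iff)
    ultimately show ?thesis by (simp add: uv(1))
  qed
  have "finite (edges G)"
  proof (rule finite_subset)
    show "edges G \<subseteq> (\<lambda>a. {fst a, snd a}) ` parcs G" by (force simp: edges_def)
  qed simp
  then have "(\<Sum>e\<in>edges G. \<Sum>a\<in>{a \<in> parcs G. {fst a, snd a} = e}. \<mu> (fst a) * \<mu> (snd a))
      = (\<Sum>a\<in>parcs G. \<mu> (fst a) * \<mu> (snd a))"
    by (intro sum.group) (fastforce simp: edges_def)+
  then have "2 * (\<Sum>e\<in>edges G. \<Prod>v\<in>e. \<mu> v) = (\<Sum>a\<in>parcs G. \<mu> (fst a) * \<mu> (snd a))"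
    using fiber by (simp add: sum_distrib_left)
  also have "\<dots> = (\<Sum>(u, w)\<in>Sigma V N. \<mu> u * \<mu> w)"
  proof (rule sum.cong)
    show "parcs G = Sigma V N" using in_arcsD1 by (auto simp: nbhd_iff)
  qed auto
  also have "\<dots> = (\<Sum>u\<in>V. \<Sum>w\<in>N u. \<mu> u * \<mu> w)"
    by (rule sum.Sigma[symmetric]) auto
  finally show ?thesis .
qed

lemma handshake: "2 * card (edges G) = card V * k"
proof -
  have "2 * real (card (edges G)) = real (card V * k)"
    using sum_edges[of "\<lambda>_. 1"] by (simp add: card_nbhd)
  then show ?thesis by linarith
qed

lemma card_verts_pos: "0 < card V"
  using nonempty by (simp add: card_gt_0_iff)

text \<open>The left side of the last hypothesis counts arcs and so is twice the edge sum of the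
  half with weight 1 on \<open>A\<close> and \<open>t\<close> on \<open>B\<close>; hence 25 and not
  50 in its denominator.\<close>

lemma two_level_half:
  fixes t :: real
  assumes AB: "A \<subseteq> V" "B \<subseteq> V" "A \<inter> B = {}" and t: "0 \<le> t" "t \<le> 1"
    and half: "card A + t * card B = card V / 2"
    and le: "arcs_between A A + 2 * t * arcs_between A B + t\<^sup>2 * arcs_between B B \<le> (card V)\<^sup>2 / 25"
  shows "sparse_half_density G \<le> 1 / 50"
proof -
  have fin: "finite A" "finite B" using AB finite_subset[OF _ finite_verts] by blast+
  define \<mu> :: "'a \<Rightarrow> real" where "\<mu> = (\<lambda>v. of_bool (v \<in> A) + t * of_bool (v \<in> B))"
  have sum_\<mu>: "(\<Sum>v\<in>V. f v * \<mu> v) = sum f A + t * sum f B" for f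
  proof -
    have "(\<Sum>v\<in>V. f v * \<mu> v) = (\<Sum>v\<in>V. f v * of_bool (v \<in> A) + t * (f v * of_bool (v \<in> B)))"
      by (intro sum.cong) (simp_all add: \<mu>_def algebra_simps)
    then show ?thesis
      using AB by (simp only: sum.distrib sum_distrib_left[symmetric] sum_mult_indicator[OF finite_verts])
  qed
  have nb: "(\<Sum>w\<in>N u. \<mu> w) = card (N u \<inter> A) + t * card (N u \<inter> B)" for u
    using fin by (simp add: \<mu>_def sum.distrib sum_distrib_left[symmetric] sum_of_bool_eq Int_def)
  have "\<mu> \<in> halves G"
    using sum_\<mu>[of "\<lambda>_. 1"] half t AB(3) by (auto simp: halves_def \<mu>_def)
  then have inf: "sparse_half_density G \<le> half_density G \<mu>"
    by (rule sparse_half_density_is_minimum(2)[OF pair_graph_axioms])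
  have "2 * (\<Sum>e\<in>edges G. \<Prod>v\<in>e. \<mu> v)
      = (\<Sum>u\<in>V. (card (N u \<inter> A) + t * card (N u \<inter> B)) * \<mu> u)"
    by (simp add: sum_edges sum_distrib_left[symmetric] nb mult.commute)
  also have "\<dots> = arcs_between A A + 2 * t * arcs_between A B + t\<^sup>2 * arcs_between B B"
    unfolding sum_\<mu> using arg_cong[OF arcs_between_commute[OF fin], of real]
    by (simp add: arcs_between_def sum.distrib sum_distrib_left[symmetric] power2_eq_square algebra_simps)
  finally have "2 * (\<Sum>e\<in>edges G. \<Prod>v\<in>e. \<mu> v) \<le> (card V)\<^sup>2 / 25" using le by simp
  then have "(\<Sum>e\<in>edges G. \<Prod>v\<in>e. \<mu> v) / (real (card V))\<^sup>2 \<le> 1 / 50"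
    using card_verts_pos by (subst pos_divide_le_eq) auto
  then have "half_density G \<mu> \<le> 1 / 50" by (simp add: half_density_def)
  then show ?thesis using inf by linarith
qed

text \<open>Each of the \<open>n k / 2\<close> edges has weight 1/4 in the constant half, whose
  density is therefore \<open>k / (8 n)\<close>.\<close>

lemma sparse_half_low_degree:
  assumes "25 * k \<le> 4 * card V"
  shows "sparse_half_density G \<le> 1 / 50"
proof (rule two_level_half[of "{}" V "1/2"])
  have "real (25 * k) * card V \<le> real (4 * card V) * card V"
    using assms by (intro mult_right_mono) (simp_all only: of_nat_le_iff of_nat_0_le_iff)
  then show "real (arcs_between {} {}) + 2 * (1 / 2) * real (arcs_between {} V)
      + (1 / 2)\<^sup>2 * real (arcs_between V V) \<le> real ((card V)\<^sup>2) / 25"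
    by (simp add: arcs_between_verts) (simp add: arcs_between_def power2_eq_square algebra_simps)
qed auto

text \<open>The graph is a perfect matching. One end of each edge gives an independent set of half
  the vertices, hence a half of density 0.\<close>

lemma sparse_half_matching:
  assumes "k = 1"
  shows "sparse_half_density G \<le> 1 / 50"
proof -
  define f :: "'a set \<Rightarrow> 'a" where "f e = (SOME v. v \<in> e)" for e
  have f: "f e \<in> e" if "e \<in> edges G" for e
    using that unfolding f_def by (intro someI_ex[of "\<lambda>v. v \<in> e"]) (auto simp: edges_def)
  have uniq: "e = {v, w}" if e: "e \<in> edges G" "v \<in> e" "w \<in> N v" for e v w
  proof -
    obtain a b where ab: "e = {a, b}" "b \<in> N a" using e by (auto simp: edges_def nbhd_iff)
    have "card (N v) = 1" using card_nbhd assms e(3) nbhd_verts by blast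
    then obtain z where "N v = {z}" by (auto simp: card_1_singleton_iff)
    then show ?thesis using ab e nbhd_sym by fastforce
  qed
  define A where "A = f ` edges G"
  have AV: "A \<subseteq> V"
    using f edges_subset_pverts[OF pair_graph_axioms] by (auto simp: A_def)
  have "inj_on f (edges G)"
  proof (rule inj_onI)
    fix e e' assume h: "e \<in> edges G" "e' \<in> edges G" "f e = f e'"
    then obtain w where "w \<in> N (f e)"
      using AV card_nbhd[of "f e"] assms by (fastforce simp: A_def card_1_singleton_iff)
    then show "e = e'" using uniq f h by metis
  qed
  then have "card A = card (edges G)" by (simp add: A_def card_image)
  then have "2 * card A = card V" using handshake assms by simp
  \<comment> \<open>Adjacent \<open>x\<close> and \<open>y\<close> in \<open>A\<close> would both be
    the representative of the edge \<open>{x, y}\<close>.\<close>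
  moreover have "N x \<inter> A = {}" if x: "x \<in> A" for x
  proof -
    have False if y: "y \<in> N x" "y \<in> A" for y
    proof -
      obtain e e' where e: "e \<in> edges G" "x = f e" "e' \<in> edges G" "y = f e'"
        using x y by (auto simp: A_def)
      then have "e = {x, y}" "e' = {y, x}" using uniq f y nbhd_sym by metis+
      then have "x = y" using e by (metis insert_commute)
      then show False using y by simp
    qed
    then show ?thesis by blast
  qed
  then have "arcs_between A A = 0" by (simp add: arcs_between_def)
  ultimately show ?thesis
    using AV by (intro two_level_half[of A "{}" 0]) auto
qed

end

section \<open>Relations between the parameters of a strongly regular graph\<close>

locale tf_strongly_regular = tf_regular +
  fixes c :: nat
  assumes card_common: "v \<in> pverts G \<Longrightarrow> w \<in> pverts G \<Longrightarrow> v \<noteq> w \<Longrightarrow> (v, w) \<notin> parcs G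
      \<Longrightarrow> card (nbhd G v \<inter> nbhd G w) = c"
    and k_ge_2: "2 \<le> k"
begin

lemma card_nbhd_Int_nbhd:
  "v \<in> V \<Longrightarrow> w \<in> V \<Longrightarrow> v \<noteq> w \<Longrightarrow> w \<notin> N v \<Longrightarrow> card (N v \<inter> N w) = c"
  using card_common by (simp add: nbhd_iff)

text \<open>For a vertex \<open>v\<close> these are the vertices at distance two, as
  \<open>c_pos\<close> gives each of them a common neighbour with \<open>v\<close>.\<close>

definition second :: "'a \<Rightarrow> 'a set" where
  "second v = V - insert v (N v)"

lemma finite_second [simp]: "finite (second v)"
  by (simp add: second_def)

lemma card_second_Int: "v \<in> V \<Longrightarrow> x \<in> second v \<Longrightarrow> card (N x \<inter> N v) = c"
  using card_nbhd_Int_nbhd[of x v] nbhd_sym by (auto simp: second_def)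

lemma card_Int_second:
  assumes "v \<in> V" "x \<in> second v"
  shows "card (N x \<inter> second v) + c = k"
proof -
  have "N x = (N x \<inter> second v) \<union> (N x \<inter> N v)"
    using assms nbhd_verts nbhd_sym by (auto simp: second_def)
  moreover have "card ((N x \<inter> second v) \<union> (N x \<inter> N v)) = card (N x \<inter> second v) + card (N x \<inter> N v)"
    by (intro card_Un_disjoint) (auto simp: second_def)
  ultimately have "card (N x) = card (N x \<inter> second v) + card (N x \<inter> N v)" by simp
  then show ?thesis using card_second_Int[OF assms] card_nbhd assms by (auto simp: second_def)
qed

lemma card_verts_eq:
  assumes "v \<in> V"
  shows "card V = card (second v) + k + 1"
proof -
  have "card (second v) = card V - card (insert v (N v))"
    unfolding second_def using assms nbhd_subset by (intro card_Diff_subset) auto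
  moreover have "card (insert v (N v)) \<le> card V"
    using assms nbhd_subset by (intro card_mono) auto
  ultimately show ?thesis using card_nbhd[OF assms] by simp
qed

text \<open>Double counting of the \<open>k * k\<close> arcs ending in \<open>N v\<close>:
  \<open>c\<close> start at each vertex of \<open>second v\<close>, \<open>k\<close> start at
  \<open>v\<close>, and none start in \<open>N v\<close>, which is independent.\<close>

lemma card_second:
  assumes v: "v \<in> V"
  shows "c * card (second v) + k = k * k"
proof -
  have V: "V = second v \<union> insert v (N v)"
    using v nbhd_subset by (auto simp: second_def)
  have "k * k = arcs_between V (N v)"
    using card_nbhd[OF v] by (simp add: arcs_between_verts nbhd_subset)
  also have "\<dots> = arcs_between (second v) (N v) + arcs_between (insert v (N v)) (N v)"
    by (subst V) (auto simp: arcs_between_def second_def intro!: sum.union_disjoint)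
  also have "arcs_between (second v) (N v) = card (second v) * c"
    using v card_second_Int by (intro arcs_between_const)
  also have "arcs_between (insert v (N v)) (N v) = k"
    using card_nbhd[OF v] nbhd_Int_nbhd by (simp add: arcs_between_def)
  finally show ?thesis by simp
qed

lemma c_pos: "0 < c"
proof -
  obtain v where "v \<in> V" using nonempty by blast
  then show ?thesis using card_second[of v] k_ge_2 by (cases c) auto
qed

lemma c_le_k: "c \<le> k"
proof -
  obtain v where v: "v \<in> V" using nonempty by blast
  then have "c * card (second v) \<noteq> 0" using card_second[OF v] k_ge_2 by (intro notI) auto
  then obtain x where "x \<in> second v" by fastforce
  then show ?thesis using card_Int_second[OF v] by force
qed

lemma second_nonempty: "v \<in> V \<Longrightarrow> second v \<noteq> {}"
  using card_second[of v] k_ge_2 by auto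

text \<open>Let \<open>x\<close> be at distance two from \<open>v\<close>. As \<open>c < k\<close>,
  it has a neighbour \<open>y\<close> also at distance two, and \<open>N x\<close> and
  \<open>N y\<close> cut disjoint sets of size \<open>c\<close> out of \<open>N v\<close>. If
  \<open>k = 2 * c\<close>, these two sets partition \<open>N v\<close>, so all such
  \<open>y\<close> have the same trace; this is too much overlap unless \<open>y\<close> is unique,
  that is, \<open>k - c = 1\<close>.\<close>

lemma two_c_le_k:
  assumes "c < k"
  shows "2 * c \<le> k" and "k = 2 * c \<Longrightarrow> c = 1"
proof -
  obtain v where v: "v \<in> V" using nonempty by blast
  obtain x where x: "x \<in> second v" using second_nonempty[OF v] by blast
  have cx: "card (N x \<inter> second v) = k - c" using card_Int_second[OF v x] by simp
  have disj: "(N x \<inter> N v) \<inter> (N y \<inter> N v) = {}" if "y \<in> N x" for y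
    using nbhd_Int_nbhd[OF that] by blast
  have "card (N x \<inter> second v) \<noteq> 0" using cx assms by simp
  then obtain y where y: "y \<in> N x \<inter> second v" by (metis card.empty ex_in_conv)
  have "card (N x \<inter> N v) + card (N y \<inter> N v) \<le> card (N v)"
    using disj[of y] y by (subst card_Un_disjoint[symmetric]) (auto intro!: card_mono)
  then show "2 * c \<le> k"
    using card_second_Int[OF v] x y card_nbhd[OF v] by auto
  assume k: "k = 2 * c"
  show "c = 1"
  proof (rule ccontr)
    assume "c \<noteq> 1"
    then have "\<not> card (N x \<inter> second v) \<le> Suc 0" using cx k c_pos by simp
    then obtain y' where y': "y' \<in> N x \<inter> second v" "y' \<noteq> y"
      using y by (auto simp: card_le_Suc0_iff_eq)
    have trace: "N z \<inter> N v = N v - N x" if z: "z \<in> N x \<inter> second v" for z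
    proof (rule card_subset_eq)
      show "N z \<inter> N v \<subseteq> N v - N x" using disj[of z] z by blast
      have "card (N v - N x) = card (N v) - card (N x \<inter> N v)"
        by (metis card_Diff_subset_Int finite_Int finite_nbhd Int_commute)
      then show "card (N z \<inter> N v) = card (N v - N x)"
        using card_second_Int[OF v] x z card_nbhd[OF v] k by auto
    qed simp
    \<comment> \<open>The shared trace has \<open>c\<close> elements, and \<open>x\<close> is a
      further common neighbour of \<open>y\<close> and \<open>y'\<close>.\<close>
    have "insert x (N v - N x) \<subseteq> N y \<inter> N y'"
      using trace[OF y] trace[OF y'(1)] y y' nbhd_sym by blast
    then have "card (insert x (N v - N x)) \<le> card (N y \<inter> N y')" by (intro card_mono) auto
    moreover have "card (insert x (N v - N x)) = Suc c"
      using trace[OF y] card_second_Int[OF v, of y] x y by (simp add: second_def)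
    moreover have "card (N y \<inter> N y') = c"
      using y y' nbhd_indep[of y x y'] by (intro card_nbhd_Int_nbhd) (auto simp: second_def)
    ultimately show False by simp
  qed
qed

section \<open>Second moments and the Krein condition\<close>

text \<open>The square counts ordered pairs in \<open>S\<close> having \<open>j\<close> as common
  neighbour. Summed over \<open>j\<close>, a diagonal pair gives \<open>k\<close> and any other pair
  gives \<open>c\<close>, since \<open>S\<close> lies in a neighbourhood and is independent.\<close>

lemma sum_card_nbhd_Int_sq:
  assumes "finite S" "S \<subseteq> N x"
  shows "(\<Sum>j\<in>V. (card (N j \<inter> S))\<^sup>2) = card S * k + card S * (card S - 1) * c"
proof -
  have card_Int: "card (N p \<inter> N q) = of_bool (p = q) * k + of_bool (p \<noteq> q) * c" if "p \<in> S" "q \<in> S" for p q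
  proof (cases "p = q")
    case True
    then show ?thesis using that assms(2) card_nbhd nbhd_verts(2) by auto
  next
    case False
    have "p \<in> N x" "q \<in> N x" using that assms(2) by auto
    then show ?thesis
      using False card_nbhd_Int_nbhd[of p q] nbhd_indep[of p x q] nbhd_verts(2) by simp
  qed
  have "(\<Sum>j\<in>V. (card (N j \<inter> S))\<^sup>2)
      = (\<Sum>j\<in>V. \<Sum>p\<in>S. \<Sum>q\<in>S. of_bool (p \<in> N j) * of_bool (q \<in> N j))"
    by (simp only: card_nbhd_Int[OF assms(1)] power2_eq_square sum_product)
  also have "\<dots> = (\<Sum>p\<in>S. \<Sum>q\<in>S. \<Sum>j\<in>V. of_bool (p \<in> N j) * of_bool (q \<in> N j))"
    by (simp only: sum.swap[of _ S V])
  also have "\<dots> = (\<Sum>p\<in>S. \<Sum>q\<in>S. card (N p \<inter> N q))"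
  proof (intro sum.cong refl)
    fix p q
    have "N p \<inter> N q = V \<inter> {j. p \<in> N j \<and> q \<in> N j}"
      using nbhd_sym nbhd_subset by auto
    then show "(\<Sum>j\<in>V. of_bool (p \<in> N j) * of_bool (q \<in> N j)) = card (N p \<inter> N q)"
      by (simp add: sum_of_bool_eq flip: of_bool_conj)
  qed
  also have "\<dots> = (\<Sum>p\<in>S. k + (card S - 1) * c)"
  proof (intro sum.cong refl)
    fix p assume p: "p \<in> S"
    have "(\<Sum>q\<in>S. card (N p \<inter> N q)) = card (N p \<inter> N p) + (\<Sum>q\<in>S - {p}. card (N p \<inter> N q))"
      using p assms(1) by (rule sum.remove[rotated])
    also have "(\<Sum>q\<in>S - {p}. card (N p \<inter> N q)) = (\<Sum>q\<in>S - {p}. c)"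
      using p by (intro sum.cong) (auto simp: card_Int)
    finally show "(\<Sum>q\<in>S. card (N p \<inter> N q)) = k + (card S - 1) * c"
      using p card_Int[OF p p] assms(1) by simp
  qed
  finally show ?thesis by (simp add: algebra_simps)
qed

text \<open>
  The Cauchy--Schwarz inequality for the numbers \<open>|N j \<inter> N x \<inter> N v|\<close>, where \<open>v\<close> and \<open>x\<close> are at
  distance two and \<open>j\<close> runs over the vertices other than \<open>v\<close> and \<open>x\<close> that are adjacent to neither.
\<close>
lemma krein:
  fixes K C :: int
  defines "K \<equiv> int k" and "C \<equiv> int c"
  shows "C\<^sup>2 * (K - 2)\<^sup>2 \<le> (K + C\<^sup>2 - 3 * C) * (K\<^sup>2 - K - C - C * K + C\<^sup>2)"
proof -
  obtain v where v: "v \<in> V" using nonempty by blast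
  obtain x where x: "x \<in> second v" using second_nonempty[OF v] by blast
  define T where "T = N x \<inter> N v"
  define D where "D = second v - insert x (N x)"
  define f where "f j = card (N j \<inter> T)" for j
  have T: "T \<subseteq> N v" "T \<subseteq> V" "card T = c" "finite T"
    using card_second_Int[OF v x] nbhd_subset by (auto simp: T_def)
  have V: "V = D \<union> ({v, x} \<union> (N v \<union> N x))"
    using v x nbhd_subset by (auto simp: D_def second_def)
  have f0: "f j = 0" if "j \<in> N v \<union> N x" for j
    using that nbhd_Int_nbhd by (auto simp: f_def T_def)
  have fc: "f v = c" "f x = c"
    using T(3) by (auto simp: f_def T_def Int_absorb1 Int_ac)
  have vx: "v \<noteq> x" "v \<notin> N v \<union> N x" "x \<notin> N v \<union> N x"
    using x nbhd_sym by (auto simp: second_def)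
  \<comment> \<open>Outside \<open>D\<close> the function \<open>f\<close> vanishes except at
    \<open>v\<close> and \<open>x\<close>, where it equals \<open>c\<close>; sums over
    \<open>D\<close> are thus obtained from sums over all vertices.\<close>
  have sum_V: "(\<Sum>j\<in>V. g (f j)) = (\<Sum>j\<in>D. g (f j)) + 2 * g c" if "g 0 = 0" for g :: "nat \<Rightarrow> nat"
  proof -
    have "(\<Sum>j\<in>V. g (f j)) = (\<Sum>j\<in>D. g (f j)) + (\<Sum>j\<in>{v, x} \<union> (N v \<union> N x). g (f j))"
      by (subst V, rule sum.union_disjoint) (use nbhd_sym in \<open>auto simp: D_def second_def\<close>)
    also have "(\<Sum>j\<in>{v, x} \<union> (N v \<union> N x). g (f j)) = (\<Sum>j\<in>{v, x}. g (f j))"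
      using that f0 by (intro sum.mono_neutral_right) auto
    finally show ?thesis using vx fc by simp
  qed
  have s1: "(\<Sum>j\<in>D. f j) + 2 * c = c * k"
    using sum_V[of "\<lambda>m. m"] arcs_between_verts[OF T(2)] T(3) by (simp add: arcs_between_def f_def)
  have s2: "(\<Sum>j\<in>D. (f j)\<^sup>2) + 2 * c\<^sup>2 = c * k + c * (c - 1) * c"
    using sum_V[of "\<lambda>m. m\<^sup>2"] sum_card_nbhd_Int_sq[OF T(4,1)] T(3) by (simp add: f_def)
  have D: "card D + (k - c + 1) = card (second v)"
  proof -
    have "second v = D \<union> insert x (N x \<inter> second v)" using x by (auto simp: D_def)
    moreover have "card (D \<union> insert x (N x \<inter> second v)) = card D + card (insert x (N x \<inter> second v))"
      by (intro card_Un_disjoint) (auto simp: D_def)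
    moreover have "card (insert x (N x \<inter> second v)) = k - c + 1"
      using card_Int_second[OF v x] by (subst card_insert_disjoint) auto
    ultimately show ?thesis by simp
  qed
  have CS: "(\<Sum>j\<in>D. int (f j))\<^sup>2 \<le> int (card D) * (\<Sum>j\<in>D. (int (f j))\<^sup>2)"
  proof -
    have "(\<Sum>j\<in>D. real (f j) * 1)\<^sup>2 \<le> (\<Sum>j\<in>D. (real (f j))\<^sup>2) * (\<Sum>j\<in>D. 1\<^sup>2)"
      by (rule Cauchy_Schwarz_ineq_sum)
    then have "real_of_int ((\<Sum>j\<in>D. int (f j))\<^sup>2) \<le> real_of_int (int (card D) * (\<Sum>j\<in>D. (int (f j))\<^sup>2))"
      by (simp add: mult.commute)
    then show ?thesis by (simp only: of_int_le_iff)
  qed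
  have i1: "(\<Sum>j\<in>D. int (f j)) = C * (K - 2)"
    using arg_cong[OF s1, of int] by (simp add: K_def C_def algebra_simps)
  have i2: "(\<Sum>j\<in>D. (int (f j))\<^sup>2) = C * (K + C\<^sup>2 - 3 * C)"
  proof -
    have "int (c - 1) = C - 1" using c_pos by (simp add: C_def of_nat_diff)
    then have "(\<Sum>j\<in>D. (int (f j))\<^sup>2) + 2 * C\<^sup>2 = C * K + C * (C - 1) * C"
      using arg_cong[OF s2, of int] by (simp add: K_def C_def)
    then show ?thesis by (simp add: algebra_simps power2_eq_square)
  qed
  \<comment> \<open>The multiple by \<open>C\<close> is polynomial in \<open>K\<close> and
    \<open>C\<close>; the factor \<open>C\<close> is supplied by the second moment
    \<open>i2\<close>.\<close>
  have i3: "C * int (card D) = K\<^sup>2 - K - C - C * K + C\<^sup>2"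
  proof -
    have D_eq: "int (card D) = int (card (second v)) - K + C - 1"
      using D c_le_k by (simp add: K_def C_def)
    have "C * int (card D) = C * int (card (second v)) - C * K + C * C - C"
      unfolding D_eq by (simp add: algebra_simps)
    moreover have "C * int (card (second v)) = K * K - K"
      using arg_cong[OF card_second[OF v], of int] by (simp add: K_def C_def)
    ultimately show ?thesis by (simp add: power2_eq_square)
  qed
  have "C\<^sup>2 * (K - 2)\<^sup>2 \<le> (C * int (card D)) * (K + C\<^sup>2 - 3 * C)"
    using CS unfolding i1 i2 by (simp add: power_mult_distrib mult_ac)
  then show ?thesis unfolding i3 by (simp add: mult.commute)
qed

section \<open>Three families of halves\<close>

text \<open>Weight 1 on \<open>N v\<close> and \<open>t\<close> on \<open>B = N w - N v\<close>:
  both sets are independent, so only arcs between them count. The first two conditions amount to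
  \<open>0 \<le> t\<close> and \<open>t \<le> 1\<close>, the third to the density bound.\<close>

lemma sparse_half_two_nbhds:
  assumes n: "2 * k \<le> card V" "card V + 2 * c \<le> 4 * k" and le: "25 * (c * (card V - 2 * k)) \<le> (card V)\<^sup>2"
  shows "sparse_half_density G \<le> 1 / 50"
proof -
  obtain v where v: "v \<in> V" using nonempty by blast
  obtain w where w: "w \<in> second v" using second_nonempty[OF v] by blast
  define B where "B = N w - N v"
  have "N w = B \<union> (N w \<inter> N v)" by (auto simp: B_def)
  moreover have "card (B \<union> (N w \<inter> N v)) = card B + card (N w \<inter> N v)"
    by (intro card_Un_disjoint) (auto simp: B_def)
  ultimately have cB: "card B + c = k"
    using card_second_Int[OF v w] card_nbhd[of w] w by (simp add: second_def)
  have "B \<subseteq> second v" using w nbhd_verts(2) nbhd_sym by (auto simp: B_def second_def)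
  then have BA: "arcs_between B (N v) = card B * c"
    using card_second_Int[OF v] by (intro arcs_between_const) auto
  \<comment> \<open>\<open>B\<close> is empty if \<open>c = k\<close>; then \<open>t = 0\<close>\<close>
  define t where "t = (real (card V) / 2 - k) / card B"
  have tB: "t * card B = real (card V) / 2 - k"
  proof (cases "card B = 0")
    case True
    then have "card V = 2 * k" using n cB by simp
    then show ?thesis using True by simp
  qed (simp add: t_def)
  show ?thesis
  proof (rule two_level_half[of "N v" B t])
    show "t \<le> 1"
    proof -
      have "real (card V) / 2 - k \<le> card B" using n cB by linarith
      then show ?thesis by (simp add: t_def divide_le_eq)
    qed
    show "0 \<le> t" using n by (simp add: t_def)
    show "card (N v) + t * card B = card V / 2" using tB card_nbhd[OF v] by simp
    have zero: "arcs_between (N v) (N v) = 0" "arcs_between B B = 0"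
      using nbhd_Int_nbhd by (auto simp: arcs_between_def B_def)
    have "2 * t * arcs_between (N v) B = 2 * c * (t * card B)"
      using BA arcs_between_commute[of "N v" B] by (simp add: B_def)
    also have "\<dots> = c * (card V - 2 * k)" unfolding tB using n by (simp add: of_nat_diff algebra_simps)
    also have "\<dots> \<le> (card V)\<^sup>2 / 25"
      using of_nat_mono[OF le, where ?'a = real] by simp
    finally show "arcs_between (N v) (N v) + 2 * t * arcs_between (N v) B + t\<^sup>2 * arcs_between B B
        \<le> (card V)\<^sup>2 / 25" using zero by simp
  qed (use nbhd_subset in \<open>auto simp: B_def\<close>)
qed

definition near :: "'a \<Rightarrow> 'a \<Rightarrow> 'a set" where
  "near v w = (N v - {w}) \<union> (N w - {v})"

text \<open>For an edge \<open>v w\<close> each end is a neighbour of the other, so the ends are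
  excluded and what remains is at distance two from both.\<close>

definition far :: "'a \<Rightarrow> 'a \<Rightarrow> 'a set" where
  "far v w = V - (N v \<union> N w)"

context
  fixes v w assumes vw: "w \<in> N v"
begin

lemma finite_near: "finite (near v w)" and finite_far: "finite (far v w)"
  by (simp_all add: near_def far_def)

lemma near_subset: "near v w \<subseteq> V" and far_subset: "far v w \<subseteq> V" and near_far: "near v w \<inter> far v w = {}"
  using nbhd_subset by (auto simp: near_def far_def)

lemma vw_verts: "v \<in> V" "w \<in> V" "v \<in> N w" "N v \<inter> N w = {}"
  using vw nbhd_verts nbhd_sym nbhd_Int_nbhd by blast+

lemma card_near: "card (near v w) = 2 * (k - 1)"
proof -
  have "card (near v w) = card (N v - {w}) + card (N w - {v})"
    unfolding near_def using vw_verts by (intro card_Un_disjoint) auto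
  then show ?thesis using vw vw_verts by (simp add: card_nbhd)
qed

lemma card_far: "card (far v w) + 2 * k = card V"
proof -
  have "card (N v \<union> N w) = 2 * k"
    using vw_verts by (simp add: card_Un_disjoint card_nbhd)
  moreover have "card (far v w) = card V - card (N v \<union> N w)"
    unfolding far_def using nbhd_subset by (intro card_Diff_subset) auto
  moreover have "card (N v \<union> N w) \<le> card V"
    using nbhd_subset by (intro card_mono) auto
  ultimately show ?thesis by simp
qed

text \<open>A vertex \<open>x\<close> in \<open>N a - {b}\<close> has no neighbour in
  \<open>N a\<close> and \<open>c\<close> common neighbours with \<open>b\<close>, one of which is
  the deleted end \<open>a\<close>.\<close>

lemma card_near_near:
  assumes "x \<in> near v w"
  shows "card (N x \<inter> near v w) = c - 1"
proof -
  have *: "card (N x \<inter> near v w) = c - 1"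
    if x: "x \<in> N a - {b}" and ab: "a \<in> N b" "near v w = (N a - {b}) \<union> (N b - {a})" for a b
  proof -
    have "N x \<inter> near v w = (N x \<inter> N b) - {a}"
      using x nbhd_indep[of x a] unfolding ab by blast
    moreover have "card (N x \<inter> N b) = c"
      using x ab nbhd_sym nbhd_indep[of x a b] nbhd_verts by (intro card_nbhd_Int_nbhd) auto
    moreover have "a \<in> N x \<inter> N b" using x ab nbhd_sym by auto
    ultimately show ?thesis by simp
  qed
  show ?thesis
    using assms *[of v w] *[of w v] vw vw_verts(3) unfolding near_def by blast
qed

lemma card_far_near:
  assumes x: "x \<in> far v w"
  shows "card (N x \<inter> near v w) = 2 * c"
proof -
  have *: "v \<notin> N x" "w \<notin> N x" using x nbhd_sym by (auto simp: far_def)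
  then have "N x \<inter> near v w = (N x \<inter> N v) \<union> (N x \<inter> N w)" by (auto simp: near_def)
  moreover have "card (N x \<inter> N v) = c" "card (N x \<inter> N w) = c"
    using * x vw vw_verts by (auto simp: far_def intro!: card_nbhd_Int_nbhd)
  ultimately show ?thesis
    using vw_verts(4) by (simp add: card_Un_disjoint Int_ac disjoint_iff)
qed

lemma card_far_far:
  assumes x: "x \<in> far v w"
  shows "card (N x \<inter> far v w) + 2 * c = k"
proof -
  have "N x = (N x \<inter> near v w) \<union> (N x \<inter> far v w)"
    using x nbhd_sym nbhd_subset by (auto simp: near_def far_def)
  moreover have "card ((N x \<inter> near v w) \<union> (N x \<inter> far v w)) = card (N x \<inter> near v w) + card (N x \<inter> far v w)"
    using near_far by (intro card_Un_disjoint) auto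
  ultimately show ?thesis
    using card_nbhd[of x] x far_subset card_far_near[OF x] by auto
qed

lemma arcs_near_near: "arcs_between (near v w) (near v w) = 2 * (k - 1) * (c - 1)"
  using arcs_between_const[OF card_near_near] card_near by simp

end

text \<open>Weight 1 on \<open>near v w\<close> and \<open>t = M / (2 * (n - 2 * k))\<close> on
  \<open>far v w\<close>, where \<open>M\<close> is twice the weight missing after
  \<open>near v w\<close>. The last hypothesis is the bound of \<open>two_level_half\<close>
  multiplied by \<open>100 * (n - 2 * k)\<close>, in integers so that it can be checked by
  evaluation.\<close>

lemma sparse_half_edge:
  fixes n M :: int
  defines "n \<equiv> int (card V)" and "M \<equiv> int (card V) - 4 * k + 4"
  assumes k: "2 * c \<le> k" and n: "2 * k < n" "0 \<le> M"
    and le: "100 * (n - 2 * k) * (2 * (int k - 1) * (int c - 1) + 2 * c * M) + 25 * M\<^sup>2 * (int k - 2 * c)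
      \<le> 4 * n\<^sup>2 * (n - 2 * k)"
  shows "sparse_half_density G \<le> 1 / 50"
proof -
  obtain v where v: "v \<in> V" using nonempty by blast
  then obtain w where w: "w \<in> N v" using card_nbhd[OF v] k_ge_2 by fastforce
  note fin = finite_near[OF w] finite_far[OF w]
  let ?A = "near v w" and ?B = "far v w"
  define l m where "l = real (card V) - 2 * real k" and "m = real (card V) - 4 * real k + 4"
  define t where "t = m / (2 * l)"
  have M_eq: "real_of_int M = m" and L_eq: "real_of_int (n - 2 * k) = l"
    by (simp_all add: M_def m_def n_def l_def)
  have l: "0 < l" "real (card ?B) = l" using n(1) card_far[OF w] by (auto simp: n_def l_def)
  have AB: "real (arcs_between ?A ?B) = l * (2 * real c)"
    using arcs_between_commute[OF fin] arcs_between_const[OF card_far_near[OF w]] l by simp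
  have "arcs_between ?B ?B = card ?B * (k - 2 * c)"
    using card_far_far[OF w] by (intro arcs_between_const) force
  then have BB: "real (arcs_between ?B ?B) = l * (real k - 2 * real c)"
    using k l by (simp add: of_nat_diff)
  have AA: "real (arcs_between ?A ?A) = 2 * (real k - 1) * (real c - 1)"
    using k_ge_2 c_pos by (simp add: arcs_near_near[OF w] of_nat_diff)
  show ?thesis
  proof (rule two_level_half[of ?A ?B t])
    have "0 \<le> m" using n(2) M_eq by linarith
    then show "0 \<le> t" using l by (simp add: t_def)
    \<comment> \<open>This amounts to \<open>4 \<le> card V\<close>, which follows from
      \<open>2 * k < card V\<close>.\<close>
    have "m \<le> 2 * l" using n(1) k_ge_2 by (simp add: m_def l_def n_def)
    then show "t \<le> 1" using l(1) by (simp add: t_def)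
    have tB: "t * card ?B = m / 2" using l by (simp add: t_def)
    have cA: "real (card ?A) = 2 * real k - 2"
      using k_ge_2 by (simp add: card_near[OF w] of_nat_diff)
    show "card ?A + t * card ?B = card V / 2" unfolding cA tB m_def by (simp add: field_simps)
    define X where "X = 2 * (real k - 1) * (real c - 1) + 2 * t * (l * (2 * real c)) + t\<^sup>2 * (l * (real k - 2 * real c))"
    have "real_of_int (100 * (n - 2 * k) * (2 * (int k - 1) * (int c - 1) + 2 * c * M) + 25 * M\<^sup>2 * (int k - 2 * c))
        \<le> real_of_int (4 * n\<^sup>2 * (n - 2 * k))"
      using le unfolding of_int_le_iff .
    then have "100 * l * (2 * (real k - 1) * (real c - 1) + 2 * real c * m) + 25 * m\<^sup>2 * (real k - 2 * real c)
        \<le> 4 * (real (card V))\<^sup>2 * l"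
      unfolding of_int_add of_int_mult L_eq M_eq of_int_power by (simp add: n_def)
    moreover have "100 * l * (2 * (real k - 1) * (real c - 1) + 2 * real c * m) + 25 * m\<^sup>2 * (real k - 2 * real c)
        = (100 * X) * l"
      using l(1) by (simp add: X_def t_def field_simps power2_eq_square)
    ultimately have "(100 * X) * l \<le> (4 * (real (card V))\<^sup>2) * l" by (simp only:)
    then have "100 * X \<le> 4 * (real (card V))\<^sup>2" using l(1) by (rule mult_right_le_imp_le)
    then show "arcs_between ?A ?A + 2 * t * arcs_between ?A ?B + t\<^sup>2 * arcs_between ?B ?B \<le> (card V)\<^sup>2 / 25"
      unfolding AA AB BB X_def by simp
  qed (rule near_subset[OF w] far_subset[OF w] near_far[OF w])+
qed

text \<open>Dropping \<open>p\<close> from \<open>near v w\<close> leaves \<open>2 * k - 3\<close>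
  vertices of weight 1, and \<open>M\<close> is twice the missing weight. It is spread over
  \<open>N p \<inter> far v w\<close>, which is independent and has \<open>k - c\<close> elements,
  whence the upper bound on \<open>M\<close>.\<close>

lemma sparse_half_path:
  fixes n M :: int
  defines "n \<equiv> int (card V)" and "M \<equiv> int (card V) - 4 * k + 6"
  assumes ck: "c < k" and M: "0 \<le> M" "M \<le> 2 * (int k - c)"
    and le: "25 * (2 * (int k - 2) * (int c - 1) + M * (2 * int c - 1)) \<le> n\<^sup>2"
  shows "sparse_half_density G \<le> 1 / 50"
proof -
  obtain v where v: "v \<in> V" using nonempty by blast
  then obtain w where w: "w \<in> N v" using card_nbhd[OF v] k_ge_2 by fastforce
  have "\<not> card (N v) \<le> Suc 0" using card_nbhd[OF v] k_ge_2 by simp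
  then obtain p where p: "p \<in> N v" "p \<noteq> w" using w by (auto simp: card_le_Suc0_iff_eq)
  define A where "A = near v w - {p}"
  define B where "B = N p \<inter> far v w"
  have p_near: "p \<in> near v w" using p by (simp add: near_def)
  have fin: "finite A" "finite B" using finite_near[OF w] by (auto simp: A_def B_def)
  have near_eq: "near v w = A \<union> {p}" "A \<inter> {p} = {}" using p_near by (auto simp: A_def)
  have pA: "arcs_between {p} A = c - 1" "arcs_between {p} {p} = 0"
  proof -
    have "N p \<inter> A = N p \<inter> near v w" by (auto simp: A_def)
    then show "arcs_between {p} A = c - 1" "arcs_between {p} {p} = 0"
      using card_near_near[OF w p_near] by (auto simp: arcs_between_def)
  qed
  \<comment> \<open>Removing \<open>p\<close> loses its \<open>c - 1\<close> inner arcs in each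
    direction.\<close>
  have "arcs_between (near v w) (near v w) = arcs_between A (A \<union> {p}) + arcs_between {p} (A \<union> {p})"
    unfolding near_eq(1) using fin near_eq(2) by (intro arcs_between_Un) auto
  also have "\<dots> = arcs_between (A \<union> {p}) A + arcs_between (A \<union> {p}) {p}"
    using fin by (simp add: arcs_between_commute[of _ "insert p A"])
  also have "\<dots> = arcs_between A A + 2 * (c - 1)"
    using fin near_eq(2) pA arcs_between_commute[of A "{p}"] by (simp add: arcs_between_Un del: Un_insert_right)
  finally have "arcs_between A A + 2 * (c - 1) = 2 * (k - 1) * (c - 1)"
    by (simp add: arcs_near_near[OF w])
  then have AA: "real (arcs_between A A) = 2 * (real k - 2) * (real c - 1)"
  proof -
    obtain a b where ab: "k = a + 2" "c = b + 1"
      using k_ge_2 c_pos by (metis add.commute le_iff_add less_iff_Suc_add Suc_eq_plus1 add_0)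
    then have "arcs_between A A = 2 * a * b"
      using \<open>arcs_between A A + 2 * (c - 1) = 2 * (k - 1) * (c - 1)\<close> by simp
    then show ?thesis using ab by simp
  qed
  \<comment> \<open>Every vertex of \<open>B\<close> is adjacent to \<open>p\<close>, so it loses
    exactly one of its \<open>2 * c\<close> neighbours in \<open>near v w\<close>.\<close>
  have "N x \<inter> A = N x \<inter> near v w - {p}" "p \<in> N x \<inter> near v w" if "x \<in> B" for x
    using that p_near nbhd_sym by (auto simp: A_def B_def)
  then have "arcs_between B A = card B * (2 * c - 1)"
    using card_far_near[OF w] by (intro arcs_between_const) (simp add: B_def)
  then have AB: "real (arcs_between A B) = card B * (2 * real c - 1)"
    using arcs_between_commute[OF fin] c_pos by (simp add: of_nat_diff)
  have BB: "arcs_between B B = 0"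
    using nbhd_Int_nbhd by (auto simp: arcs_between_def B_def)
  \<comment> \<open>The neighbours of \<open>p\<close> are \<open>v\<close>, \<open>c - 1\<close>
    vertices of \<open>near v w\<close>, and \<open>B\<close>; this gives the size of
    \<open>B\<close>.\<close>
  have "N p = insert v ((N p \<inter> near v w) \<union> B)"
    using p nbhd_sym nbhd_subset nbhd_indep[OF p(1) w] by (auto simp: near_def far_def B_def)
  moreover have "card (insert v ((N p \<inter> near v w) \<union> B)) = Suc (card ((N p \<inter> near v w) \<union> B))"
    using w nbhd_sym by (intro card_insert_disjoint) (auto simp: near_def far_def B_def)
  moreover have "card ((N p \<inter> near v w) \<union> B) = card (N p \<inter> near v w) + card B"
    using near_far[OF w] by (intro card_Un_disjoint) (auto simp: B_def)
  ultimately have "k = Suc (c - 1 + card B)"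
    using card_near_near[OF w p_near] card_nbhd[of p] nbhd_verts(2)[OF p(1)] by simp
  then have cB: "real (card B) = real k - c" "0 < card B" using ck c_pos by auto
  have cA: "real (card A) = 2 * real k - 3"
    using p_near finite_near[OF w] card_near[OF w] k_ge_2 by (simp add: A_def of_nat_diff)
  define t where "t = M / (2 * card B)"
  have tB: "t * card B = M / 2" using cB(2) by (simp add: t_def)
  show ?thesis
  proof (rule two_level_half[of A B t])
    show "A \<subseteq> V" "B \<subseteq> V" "A \<inter> B = {}"
      using near_subset[OF w] far_subset[OF w] near_far[OF w] by (auto simp: A_def B_def)
    show "0 \<le> t" using M by (simp add: t_def)
    have "real_of_int M \<le> real_of_int (2 * (int k - c))"
      using M(2) unfolding of_int_le_iff .
    then have "real_of_int M \<le> 2 * real (card B)" using cB(1) by simp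
    then show "t \<le> 1" using cB(2) by (simp add: t_def)
    show "card A + t * card B = card V / 2"
    proof -
      have "real_of_int M = real (card V) - 4 * k + 6" by (simp add: M_def)
      then show ?thesis unfolding tB cA by linarith
    qed
    have "real_of_int (25 * (2 * (int k - 2) * (int c - 1) + M * (2 * int c - 1))) \<le> real_of_int (n\<^sup>2)"
      using le unfolding of_int_le_iff .
    then have "25 * (2 * (real k - 2) * (real c - 1) + M * (2 * real c - 1)) \<le> (card V)\<^sup>2"
      by (simp add: n_def)
    moreover have "2 * t * arcs_between A B = M * (2 * real c - 1)"
      using tB unfolding AB by (simp add: algebra_simps)
    ultimately show "arcs_between A A + 2 * t * arcs_between A B + t\<^sup>2 * arcs_between B B \<le> (card V)\<^sup>2 / 25"
      unfolding AA BB by simp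
  qed
qed

end

section \<open>Reduction to finitely many parameters\<close>

text \<open>
  The two disjuncts are the numerical conditions of \<open>sparse_half_edge\<close> and \<open>sparse_half_path\<close>. Parity is
  needed only against \<open>n = 53\<close>, \<open>k = 13\<close>, \<open>c = 4\<close>.
\<close>
lemma feasible_parameters:
  "\<forall>c\<in>set [1..16]. \<forall>k\<in>set [2 * c + 1..84]. k * (k - 1) mod c = 0 \<longrightarrow>
    (let n = 1 + k + k * (k - 1) div c in 4 * n < 25 * k \<longrightarrow>
      c\<^sup>2 * (k - 2)\<^sup>2 \<le> (k + c\<^sup>2 - 3 * c) * (k\<^sup>2 - k - c - c * k + c\<^sup>2) \<longrightarrow> n * k mod 2 = 0 \<longrightarrow>
      (let M = n - 4 * k + 4 in 2 * k < n \<and> 0 \<le> M \<and>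
        100 * (n - 2 * k) * (2 * (k - 1) * (c - 1) + 2 * c * M) + 25 * M\<^sup>2 * (k - 2 * c) \<le> 4 * n\<^sup>2 * (n - 2 * k)) \<or>
      (let M = n - 4 * k + 6 in 0 \<le> M \<and> M \<le> 2 * (k - c) \<and>
        25 * (2 * (k - 2) * (c - 1) + M * (2 * c - 1)) \<le> n\<^sup>2))"
  by code_simp

text \<open>In terms of \<open>d = k - 2 * c\<close> the Krein inequality has the positive factor
  \<open>d + c\<close>; cancelling it bounds a cubic in \<open>c\<close> by a quadratic in
  \<open>d\<close> and \<open>c\<close>. The density condition bounds \<open>d\<close> linearly in
  \<open>c\<close>, so \<open>c\<close> is bounded.\<close>

lemma degree_bounds:
  fixes c k n :: int
  assumes c: "1 \<le> c" and k: "2 * c < k" and n: "c * (n - 1 - k) = k * (k - 1)" "4 * n < 25 * k"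
    and krein: "c\<^sup>2 * (k - 2)\<^sup>2 \<le> (k + c\<^sup>2 - 3 * c) * (k\<^sup>2 - k - c - c * k + c\<^sup>2)"
  shows "c \<le> 16" and "k \<le> 84"
proof -
  define d where "d = k - 2 * c"
  have "0 \<le> (d\<^sup>2 + d * (c - 1) - c * (c - 1)\<^sup>2) * (d + c)"
    using krein by (simp add: d_def power2_eq_square algebra_simps)
  moreover have "0 < d + c" using c k by (simp add: d_def)
  ultimately have krein': "c * (c - 1)\<^sup>2 \<le> d\<^sup>2 + d * (c - 1)"
    by (simp add: zero_le_mult_iff)
  have "c * (4 * n) < c * (25 * k)" using n(2) c by simp
  then have "4 * (k * (k - 1)) + 4 * c * (1 + k) < 25 * c * k"
    unfolding n(1)[symmetric] by (simp add: algebra_simps)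
  then have "k * (4 * k) < k * (21 * c + 4)" using c by (simp add: algebra_simps)
  then have k_le: "4 * k \<le> 21 * c + 3" using c k by (simp add: mult_less_cancel_left)
  then have d_le: "4 * d \<le> 13 * c + 3" by (simp add: d_def)
  have "0 \<le> d" using k by (simp add: d_def)
  show "c \<le> 16"
  proof (rule ccontr)
    assume "\<not> c \<le> 16"
    then have c17: "17 \<le> c" by simp
    \<comment> \<open>After multiplication by 16, the right side of \<open>krein'\<close> is at most
      \<open>221 c^2 + 38 c - 3\<close>, while the left side is at least
      \<open>256 c (c - 1)\<close>.\<close>
    have "(4 * d)\<^sup>2 \<le> (13 * c + 3)\<^sup>2" using d_le \<open>0 \<le> d\<close> by (intro power_mono) auto
    moreover have "(4 * d) * (c - 1) \<le> (13 * c + 3) * (c - 1)" using d_le c by (intro mult_right_mono) auto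
    moreover have "c * (c - 1) * 16 \<le> c * (c - 1) * (c - 1)" using c17 by (intro mult_left_mono) auto
    moreover have "17 * c \<le> c * c" using c17 by (intro mult_right_mono) auto
    ultimately show False
      using krein' c17 unfolding power2_eq_square by (simp only: algebra_simps)
  qed
  \<comment> \<open>\<open>21 * 16 + 3 = 339\<close> is less than \<open>4 * 85\<close>.\<close>
  then show "k \<le> 84" using k_le by simp
qed

section \<open>Case distinction on the parameters and the degree\<close>

context tf_strongly_regular
begin

lemma sparse_half_strongly_regular: "sparse_half_density G \<le> 1 / 50"
proof -
  obtain v where v: "v \<in> V" using nonempty by blast
  note card_D = card_second[OF v] and card_V = card_verts_eq[OF v]
  consider "25 * k \<le> 4 * card V" | "c = k" | "c < k" "k = 2 * c" | "4 * card V < 25 * k" "2 * c < k"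
    using c_le_k two_c_le_k(1) by linarith
  then show ?thesis
  proof cases
    case 1
    then show ?thesis by (rule sparse_half_low_degree)
  next
    case 2
    \<comment> \<open>Non-adjacent vertices have equal neighbourhoods here, so the graph is complete
      bipartite and \<open>N v\<close> is half of the vertices.\<close>
    then have "k * (card (second v) + 1) = k * k" using card_D by simp
    then have "card (second v) + 1 = k" using k_ge_2 unfolding mult_cancel1 by simp
    then have "card V = 2 * k" using card_V by simp
    then show ?thesis using 2 by (intro sparse_half_two_nbhds) auto
  next
    case 3
    then have "c = 1" by (intro two_c_le_k(2))
    then have "card V = 5" using card_V card_D 3 by simp
    \<comment> \<open>For the pentagon parameters the density of this half is exactly 1/50.\<close>
    then show ?thesis using 3 \<open>c = 1\<close> by (intro sparse_half_two_nbhds) auto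
  next
    case 4
    define K C n where "K = int k" and "C = int c" and "n = int (card V)"
    have n: "n - 1 - K = int (card (second v))" using card_V by (simp add: K_def n_def)
    have Cn: "C * (n - 1 - K) = K * (K - 1)"
      using arg_cong[OF card_D, of int] unfolding n by (simp add: K_def C_def algebra_simps)
    have C: "1 \<le> C" "2 * C < K" and dens: "4 * n < 25 * K"
      using c_pos 4 by (simp_all add: K_def C_def n_def)
    note krein = krein[folded K_def C_def]
    have bounds: "C \<le> 16" "K \<le> 84" using degree_bounds[OF C Cn dens krein] by auto
    have "n * K = 2 * int (card (edges G))"
      using arg_cong[OF handshake, of int] by (simp add: n_def K_def)
    then have even: "n * K mod 2 = 0" by simp
    \<comment> \<open>The evaluated statement computes \<open>n\<close> from \<open>K\<close> and
      \<open>C\<close> by a division; divisibility makes it exact and identifies the result with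
      \<open>card V\<close>.\<close>
    have mod: "K * (K - 1) mod C = 0" unfolding Cn[symmetric] by simp
    have "K * (K - 1) div C = n - 1 - K" unfolding Cn[symmetric] using C by simp
    then have n_eq: "1 + K + K * (K - 1) div C = n" by simp
    have "(let M = n - 4 * K + 4 in 2 * K < n \<and> 0 \<le> M \<and>
        100 * (n - 2 * K) * (2 * (K - 1) * (C - 1) + 2 * C * M) + 25 * M\<^sup>2 * (K - 2 * C) \<le> 4 * n\<^sup>2 * (n - 2 * K)) \<or>
      (let M = n - 4 * K + 6 in 0 \<le> M \<and> M \<le> 2 * (K - C) \<and>
        25 * (2 * (K - 2) * (C - 1) + M * (2 * C - 1)) \<le> n\<^sup>2)"
      using feasible_parameters[rule_format, of C K, unfolded n_eq Let_def[of n]] C bounds mod dens krein even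
      by simp
    then show ?thesis
    proof
      assume "let M = n - 4 * K + 4 in 2 * K < n \<and> 0 \<le> M \<and>
        100 * (n - 2 * K) * (2 * (K - 1) * (C - 1) + 2 * C * M) + 25 * M\<^sup>2 * (K - 2 * C) \<le> 4 * n\<^sup>2 * (n - 2 * K)"
      then show ?thesis
        using 4 unfolding Let_def K_def C_def n_def by (intro sparse_half_edge) simp_all
    next
      assume "let M = n - 4 * K + 6 in 0 \<le> M \<and> M \<le> 2 * (K - C) \<and>
        25 * (2 * (K - 2) * (C - 1) + M * (2 * C - 1)) \<le> n\<^sup>2"
      then show ?thesis
        using 4 unfolding Let_def K_def C_def n_def by (intro sparse_half_path) simp_all
    qed
  qed
qed

end

theorem theorem3p5:
  fixes G :: "'a pair_pre_digraph"
  assumes "triangle_free_strongly_regular G"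
    and "pverts G \<noteq> {}"
  shows "sparse_half_density G \<le> 1 / 50"
proof -
  obtain k c where k: "\<forall>v \<in> pverts G. card (nbhd G v) = k"
    and c: "\<forall>v \<in> pverts G. \<forall>w \<in> pverts G. v \<noteq> w \<and> (v, w) \<notin> parcs G \<longrightarrow>
        card (nbhd G v \<inter> nbhd G w) = c"
    using assms(1) by (auto simp: triangle_free_strongly_regular_def regular_def)
  interpret pair_graph G
    using assms(1) by (simp add: triangle_free_strongly_regular_def)
  interpret tf_regular G k
    using assms k by unfold_locales (auto simp: triangle_free_strongly_regular_def)
  \<comment> \<open>Edgeless graphs and perfect matchings are split off. From degree two on, two
    neighbours of one vertex form a non-adjacent pair, so \<open>c\<close> is a genuine
    parameter.\<close>
  consider "k = 0" | "k = 1" | "2 \<le> k" by linarith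
  then show ?thesis
  proof cases
    case 1
    then show ?thesis by (intro sparse_half_low_degree) simp
  next
    case 2
    then show ?thesis by (rule sparse_half_matching)
  next
    case 3
    interpret tf_strongly_regular G k c
      using c 3 by unfold_locales auto
    show ?thesis by (rule sparse_half_strongly_regular)
  qed
qed

end
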